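(* For all integers $m\geq 3$ and $n\geq 2$, $$\chi_{lid}(C_m \square P_n)=\begin{cases}5 & \text{if } m=3,\\ 4 & \text{if } m \text{ is odd and } m\geq 5,\\ 3 & \text{if } m \text{ is even}.\end{cases}$$
   Context: $P_n$ denotes the path on $n$ vertices and $C_m$ the cycle on $m$ vertices. A proper $k$-coloring of a graph $G$ is a map $f:V(G)\to\{1,\dots,k\}$ with $f(u)\neq f(v)$ for every edge $uv$. For a vertex $v$, $N[v]$ denotes its closed neighborhood, and $f(S)=\{f(x):x\in S\}$. A lid-coloring of $G$ is a proper coloring $f$ such that for every edge $uv$ with $N[u]\neq N[v]$ we have $f(N[u])\neq f(N[v])$; $\chi_{lid}(G)$ is the smallest number of colors in a lid-coloring of $G$. The Cartesian product $G\square H$ has vertex set $V(G)\times V(H)$, where $(u_1,v_1)$ and $(u_2,v_2)$ are adjacent iff either $u_1=u_2$ and $v_1v_2\in E(H)$, or $v_1=v_2$ and $u_1u_2\in E(G)$. *)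

theory Defs
  imports "Graph_Theory.Pair_Digraph"
begin

text \<open>
  A finite simple undirected graph is a \<^locale>\<open>pair_graph\<close>: a finite loopless digraph whose
  arc relation is symmetric, so that an edge \<open>uv\<close> is the pair of arcs \<open>(u, v)\<close> and \<open>(v, u)\<close>.
\<close>

definition path_graph :: "nat \<Rightarrow> nat pair_pre_digraph" where
  "path_graph n = \<lparr> pverts = {..<n},
     parcs = {(i, j). i < n \<and> j < n \<and> (j = i + 1 \<or> i = j + 1)} \<rparr>"

text \<open>The cycle on \<open>m\<close> vertices, for \<open>m \<ge> 3\<close>.\<close>

definition cycle_graph :: "nat \<Rightarrow> nat pair_pre_digraph" where
  "cycle_graph m = \<lparr> pverts = {..<m},
     parcs = {(i, j). i < m \<and> j < m \<and> (j = (i + 1) mod m \<or> i = (j + 1) mod m)} \<rparr>"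

definition cartesian_product ::
    "'a pair_pre_digraph \<Rightarrow> 'b pair_pre_digraph \<Rightarrow> ('a \<times> 'b) pair_pre_digraph" where
  "cartesian_product G H = \<lparr> pverts = pverts G \<times> pverts H,
     parcs = {((u1, v1), (u2, v2)).
       (u1 = u2 \<and> u1 \<in> pverts G \<and> (v1, v2) \<in> parcs H) \<or>
       (v1 = v2 \<and> v1 \<in> pverts H \<and> (u1, u2) \<in> parcs G)} \<rparr>"

definition closed_nbhd :: "'a pair_pre_digraph \<Rightarrow> 'a \<Rightarrow> 'a set" where
  "closed_nbhd G v = insert v {u. (v, u) \<in> parcs G}"

definition proper_coloring :: "'a pair_pre_digraph \<Rightarrow> nat \<Rightarrow> ('a \<Rightarrow> nat) \<Rightarrow> bool" where
  "proper_coloring G k f \<longleftrightarrow>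
     f ` pverts G \<subseteq> {1..k} \<and> (\<forall>(u, v) \<in> parcs G. f u \<noteq> f v)"

definition lid_coloring :: "'a pair_pre_digraph \<Rightarrow> nat \<Rightarrow> ('a \<Rightarrow> nat) \<Rightarrow> bool" where
  "lid_coloring G k f \<longleftrightarrow> proper_coloring G k f \<and>
     (\<forall>(u, v) \<in> parcs G. closed_nbhd G u \<noteq> closed_nbhd G v \<longrightarrow>
        f ` closed_nbhd G u \<noteq> f ` closed_nbhd G v)"

definition lid_chromatic_number :: "'a pair_pre_digraph \<Rightarrow> nat" where
  "lid_chromatic_number G = (LEAST k. \<exists>f. lid_coloring G k f)"

lemma pair_graphI:
  assumes "finite (pverts G)" and "parcs G \<subseteq> pverts G \<times> pverts G"
    and sym: "\<And>u v. (u, v) \<in> parcs G \<Longrightarrow> (v, u) \<in> parcs G"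
    and irrefl: "\<And>u. (u, u) \<notin> parcs G"
  shows "pair_graph G"
proof unfold_locales
  show "finite (parcs G)"
    using assms(1,2) by (meson finite_SigmaI finite_subset)
  show "symmetric G"
    by (auto simp: symmetric_def arcs_ends_def arc_to_ends_def intro!: symI dest: sym)
  fix e assume "e \<in> parcs G"
  then show "fst e \<in> pverts G" "snd e \<in> pverts G" "fst e \<noteq> snd e"
    using assms(2) irrefl by (cases e; auto)+
qed (rule assms(1))

lemma pair_graph_path_graph: "pair_graph (path_graph n)"
  by (rule pair_graphI) (auto simp: path_graph_def)

lemma pair_graph_cycle_graph:
  assumes "m \<ge> 3"
  shows "pair_graph (cycle_graph m)"
proof -
  have "(i + 1) mod m \<noteq> i" if "i < m" for i
    using that assms by (cases "i + 1 = m") auto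
  then have "i \<noteq> (i + 1) mod m" if "i < m" for i
    using that by metis
  then show ?thesis
    by (intro pair_graphI) (auto simp: cycle_graph_def)
qed

lemma pair_graph_cartesian_product:
  assumes "pair_graph G" and "pair_graph H"
  shows "pair_graph (cartesian_product G H)"
proof -
  interpret G: pair_graph G by fact
  interpret H: pair_graph H by fact
  have sym: "(v, u) \<in> parcs G" if "(u, v) \<in> parcs G" for u v
    using that G.arcs_symmetric by blast
  have sym': "(v, u) \<in> parcs H" if "(u, v) \<in> parcs H" for u v
    using that H.arcs_symmetric by blast
  show ?thesis
    by (rule pair_graphI)
      (auto simp: cartesian_product_def sym sym' G.pair_finite_verts H.pair_finite_verts
        dest: G.in_arcsD1 G.in_arcsD2 H.in_arcsD1 H.in_arcsD2 G.pair_no_loops H.pair_no_loops)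
qed

text \<open>Every finite simple graph has a lid-coloring, so the minimum above is attained.\<close>

lemma lid_coloring_exists:
  assumes "pair_graph G"
  shows "\<exists>k f. lid_coloring G k f"
proof -
  interpret pair_graph G by fact
  obtain g :: "'a \<Rightarrow> nat" and k where g: "inj_on g (pverts G)" "g ` pverts G = {i. i < k}"
    using finite_imp_inj_to_nat_seg[OF pair_finite_verts] by blast
  define f where "f = Suc \<circ> g"
  have inj: "inj_on f (pverts G)"
    using g(1) by (auto simp: f_def inj_on_def)
  have sub: "closed_nbhd G u \<subseteq> pverts G" if "u \<in> pverts G" for u
    using that in_arcsD2 by (auto simp: closed_nbhd_def)
  have "f ` pverts G \<subseteq> {1..k}"
  proof
    fix c assume "c \<in> f ` pverts G"
    then obtain x where "x \<in> pverts G" "c = Suc (g x)" by (auto simp: f_def)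
    moreover from this have "g x \<in> {i. i < k}" unfolding g(2)[symmetric] by blast
    ultimately show "c \<in> {1..k}" by auto
  qed
  moreover have "f u \<noteq> f v" if "(u, v) \<in> parcs G" for u v
    using inj_onD[OF inj _ in_arcsD1[OF that] in_arcsD2[OF that]] pair_no_loops[OF that] by auto
  moreover have "f ` closed_nbhd G u \<noteq> f ` closed_nbhd G v"
    if "(u, v) \<in> parcs G" "closed_nbhd G u \<noteq> closed_nbhd G v" for u v
    using that inj_on_image_eq_iff[OF inj sub sub] in_arcsD1 in_arcsD2 by blast
  ultimately have "lid_coloring G k f"
    unfolding lid_coloring_def proper_coloring_def by blast
  then show ?thesis by blast
qed

end

theory Submission
  imports Defs
begin

text \<open>
  \<^emph>\<open>Upper bounds.\<close> A lid-coloring of the prism over \<open>C\<^sub>m\<close> (two rows) extends to \<open>n\<close> rows by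
  repeating the two rows periodically: the rows above and below a given row then carry the same
  colors, so closed neighborhoods see the same colors as in the prism. For even \<open>m\<close> one parity
  class is monochromatic; for odd \<open>m \<ge> 5\<close> this coloring is repaired by three exceptional columns.

  \<^emph>\<open>Lower bounds.\<close> Adjacent vertices never have equal closed neighborhoods here. With three colors
  the closed neighborhoods of adjacent vertices see two and three colors respectively, so the graph
  is bipartite. With four colors and \<open>m = 3\<close>, the closed neighborhoods of the three vertices of the
  first row see either just the colors of that row or all four, so two of them agree.
\<close>

section \<open>Lid-colorings with few colors in arbitrary graphs\<close>

lemma lid_coloring_mono:
  assumes "lid_coloring G k f" and "k \<le> l"
  shows "lid_coloring G l f"
proof -
  have "f ` pverts G \<subseteq> {1..k}"
    using assms(1) by (simp add: lid_coloring_def proper_coloring_def)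
  also have "\<dots> \<subseteq> {1..l}"
    using assms(2) by simp
  finally show ?thesis
    using assms(1) by (simp add: lid_coloring_def proper_coloring_def)
qed

text \<open>By monotonicity in the number of colors, excluding \<open>k\<close> excludes everything
  below it, so one coloring and one impossibility settle the minimum.\<close>

lemma lid_chromatic_number_eqI:
  assumes "lid_coloring G (Suc k) f" and "\<And>g. \<not> lid_coloring G k g"
  shows "lid_chromatic_number G = Suc k"
  unfolding lid_chromatic_number_def
proof (rule Least_equality)
  show "\<exists>f. lid_coloring G (Suc k) f"
    using assms(1) by blast
  show "Suc k \<le> l" if "\<exists>g. lid_coloring G l g" for l
    using that assms(2) lid_coloring_mono by (metis not_less_eq_eq)
qed

lemma lid_coloring_closed_nbhd_subset:
  assumes "pair_graph G" and "lid_coloring G k f" and "u \<in> pverts G"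
  shows "f ` closed_nbhd G u \<subseteq> {1..k}"
proof -
  interpret pair_graph G by fact
  have "closed_nbhd G u \<subseteq> pverts G"
    using assms(3) in_arcsD2 by (auto simp: closed_nbhd_def)
  then show ?thesis
    using assms(2) unfolding lid_coloring_def proper_coloring_def by blast
qed

text \<open>Both color sets contain the distinct colors \<open>f u\<close> and \<open>f v\<close>,
  so within three colors each of them is either \<open>{f u, f v}\<close> or \<open>{1..3}\<close>.
  As they differ, each value occurs once.\<close>

lemma lid_coloring_three_card_neq:
  assumes "pair_graph G" and f: "lid_coloring G 3 f" and e: "(u, v) \<in> parcs G"
    and "closed_nbhd G u \<noteq> closed_nbhd G v"
  shows "(card (f ` closed_nbhd G u) = 2) \<noteq> (card (f ` closed_nbhd G v) = 2)"
proof -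
  interpret pair_graph G by fact
  let ?A = "f ` closed_nbhd G u" and ?B = "f ` closed_nbhd G v"
  have sub: "?A \<subseteq> {1..3}" "?B \<subseteq> {1..3}"
    using lid_coloring_closed_nbhd_subset[OF assms(1) f] in_arcsD1[OF e] in_arcsD2[OF e] by auto
  then have fin: "finite ?A" "finite ?B"
    by (meson finite_atLeastAtMost finite_subset)+
  have neq: "?A \<noteq> ?B" and fuv: "f u \<noteq> f v"
    using f e assms(4) unfolding lid_coloring_def proper_coloring_def by auto
  have "(v, u) \<in> parcs G"
    using e arcs_symmetric by blast
  then have uv: "{f u, f v} \<subseteq> ?A" "{f u, f v} \<subseteq> ?B"
    using e by (auto simp: closed_nbhd_def)
  have two: "X = {f u, f v}" if "card X = 2" "finite X" "{f u, f v} \<subseteq> X" for X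
    using that fuv card_subset_eq[of X "{f u, f v}"] by auto
  have three: "X = {1..3}" if "card X \<noteq> 2" "X \<subseteq> {1..3}" "finite X" "{f u, f v} \<subseteq> X" for X
  proof -
    have "card X \<ge> 2"
      using card_mono[OF that(3,4)] fuv by simp
    moreover have "card X \<le> 3"
      using card_mono[OF _ that(2)] by simp
    ultimately have "card X = 3"
      using that(1) by linarith
    then show ?thesis
      using card_subset_eq[of "{1..3}" X] that(2) by simp
  qed
  show ?thesis
    using two[of ?A] two[of ?B] three[of ?A] three[of ?B] sub fin uv neq by metis
qed

text \<open>The two ends of an edge already use both colors, so both closed neighborhoods see
  everything.\<close>

lemma not_lid_coloring_two:
  assumes "pair_graph G" and e: "(u, v) \<in> parcs G" and "closed_nbhd G u \<noteq> closed_nbhd G v"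
  shows "\<not> lid_coloring G 2 f"
proof
  assume f: "lid_coloring G 2 f"
  interpret pair_graph G by fact
  have "(v, u) \<in> parcs G"
    using e arcs_symmetric by blast
  then have uv: "{f u, f v} \<subseteq> f ` closed_nbhd G u" "{f u, f v} \<subseteq> f ` closed_nbhd G v"
    using e by (auto simp: closed_nbhd_def)
  have sub: "f ` closed_nbhd G u \<subseteq> {1..2}" "f ` closed_nbhd G v \<subseteq> {1..2}"
    using lid_coloring_closed_nbhd_subset[OF assms(1) f] in_arcsD1[OF e] in_arcsD2[OF e] by auto
  have "f u \<noteq> f v" and neq: "f ` closed_nbhd G u \<noteq> f ` closed_nbhd G v"
    using f e assms(3) unfolding lid_coloring_def proper_coloring_def by auto
  then have "card {f u, f v} = card {1..2::nat}"
    by simp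
  then have "{f u, f v} = {1..2}"
    using subset_trans[OF uv(1) sub(1)] by (intro card_subset_eq) simp_all
  then show False
    using uv sub neq by (metis subset_antisym)
qed

section \<open>Closed neighborhoods in the cylinder\<close>

definition cylinder :: "nat \<Rightarrow> nat \<Rightarrow> (nat \<times> nat) pair_pre_digraph" where
  "cylinder m n = cartesian_product (cycle_graph m) (path_graph n)"

lemma pair_graph_cylinder: "m \<ge> 3 \<Longrightarrow> pair_graph (cylinder m n)"
  unfolding cylinder_def
  by (intro pair_graph_cartesian_product pair_graph_cycle_graph pair_graph_path_graph)

lemma pverts_cylinder: "pverts (cylinder m n) = {..<m} \<times> {..<n}"
  by (auto simp: cylinder_def cartesian_product_def cycle_graph_def path_graph_def)

lemma parcs_cylinder_iff:
  "((i, j), (i', j')) \<in> parcs (cylinder m n) \<longleftrightarrow>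
    i < m \<and> i' < m \<and> j < n \<and> j' < n \<and>
    (i = i' \<and> (j' = j + 1 \<or> j = j' + 1) \<or>
     j = j' \<and> (i' = (i + 1) mod m \<or> i = (i' + 1) mod m))"
  by (auto simp: cylinder_def cartesian_product_def cycle_graph_def path_graph_def)

text \<open>Makes the cyclic predecessor explicit. Adding \<open>m - 1\<close> instead of
  subtracting 1 avoids truncated subtraction at \<open>i = 0\<close>.\<close>

lemma mod_Suc_eq_iff:
  fixes i i' m :: nat
  assumes "i < m" and "i' < m"
  shows "i = (i' + 1) mod m \<longleftrightarrow> i' = (i + (m - 1)) mod m"
proof -
  have "(i + (m - 1)) mod m = (if i = 0 then m - 1 else i - 1)"
    using assms by (auto simp: mod_if)
  moreover have "(i' + 1) mod m = (if i' = m - 1 then 0 else i' + 1)"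
    using assms by (auto simp: mod_if)
  ultimately show ?thesis
    using assms by auto
qed

lemma closed_nbhd_cylinder:
  assumes "i < m" and "j < n"
  shows "closed_nbhd (cylinder m n) (i, j) =
    {(i, j), ((i + 1) mod m, j), ((i + (m - 1)) mod m, j)} \<union>
    {i} \<times> {j'. j' < n \<and> (j' = j + 1 \<or> j = j' + 1)}"
proof (rule set_eqI)
  fix x :: "nat \<times> nat"
  obtain a b where x: "x = (a, b)"
    by (cases x)
  have lt: "(i + 1) mod m < m" "(i + (m - 1)) mod m < m"
    using assms by auto
  show "x \<in> closed_nbhd (cylinder m n) (i, j) \<longleftrightarrow>
    x \<in> {(i, j), ((i + 1) mod m, j), ((i + (m - 1)) mod m, j)} \<union>
      {i} \<times> {j'. j' < n \<and> (j' = j + 1 \<or> j = j' + 1)}"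
    using assms lt mod_Suc_eq_iff[OF assms(1), of a]
    unfolding x closed_nbhd_def parcs_cylinder_iff insert_iff mem_Collect_eq
    by auto
qed

text \<open>A neighbor of \<open>u\<close> perpendicular to the edge differs from \<open>v\<close>
  in both coordinates, hence lies outside the closed neighborhood of \<open>v\<close>.\<close>

lemma closed_nbhd_cylinder_neq:
  assumes "m \<ge> 3" and "n \<ge> 2" and e: "(u, v) \<in> parcs (cylinder m n)"
  shows "closed_nbhd (cylinder m n) u \<noteq> closed_nbhd (cylinder m n) v"
proof -
  obtain i j i' j' where uv: "u = (i, j)" "v = (i', j')"
    by (cases u, cases v)
  interpret pair_graph "cylinder m n"
    using assms(1) by (rule pair_graph_cylinder)
  have neq: "(i, j) \<noteq> (i', j')"
    using pair_no_loops[OF e] uv by simp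
  have b: "i < m" "i' < m" "j < n" "j' < n"
    using e uv by (auto simp: parcs_cylinder_iff)
  consider "i = i'" "j \<noteq> j'" | "j = j'" "i \<noteq> i'"
    using e uv neq by (auto simp: parcs_cylinder_iff)
  then show ?thesis
  proof cases
    case 1
    have "(i + 1) mod m \<noteq> i"
      using b assms(1) by (auto simp: mod_if)
    then have "((i + 1) mod m, j) \<in> closed_nbhd (cylinder m n) u"
      "((i + 1) mod m, j) \<notin> closed_nbhd (cylinder m n) v"
      using 1 b uv by (auto simp: closed_nbhd_cylinder)
    then show ?thesis by blast
  next
    case 2
    \<comment> \<open>A row next to \<open>j\<close>; in the boundary row 0 it is row 1, which
      exists since \<open>n \<ge> 2\<close>.\<close>
    define l where "l = (if j = 0 then 1 else j - 1)"
    have "l < n" "l = j + 1 \<or> j = l + 1"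
      using b assms(2) by (auto simp: l_def)
    then have "(i, l) \<in> closed_nbhd (cylinder m n) u"
      "(i, l) \<notin> closed_nbhd (cylinder m n) v"
      using 2 b uv by (auto simp: closed_nbhd_cylinder)
    then show ?thesis by blast
  qed
qed

section \<open>Lower bounds for odd cycles and for the triangle\<close>

lemma not_lid_coloring_three_odd_cylinder:
  assumes "m \<ge> 3" and "n \<ge> 2" and "odd m"
  shows "\<not> lid_coloring (cylinder m n) 3 f"
proof
  assume f: "lid_coloring (cylinder m n) 3 f"
  define h where "h i = (card (f ` closed_nbhd (cylinder m n) (i, 0)) = 2)" for i
  have h: "h i \<noteq> h ((i + 1) mod m)" if "i < m" for i
  proof -
    have e: "((i, 0), ((i + 1) mod m, 0)) \<in> parcs (cylinder m n)"
      using that assms by (auto simp: parcs_cylinder_iff)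
    show ?thesis
      using lid_coloring_three_card_neq[OF pair_graph_cylinder f e] closed_nbhd_cylinder_neq[OF _ _ e]
        assms by (simp add: h_def)
  qed
  have alt: "i < m \<Longrightarrow> h i = (h 0 = even i)" for i
  proof (induction i)
    case (Suc i)
    then show ?case using h[of i] by (cases "h 0") auto
  qed simp
  \<comment> \<open>Since \<open>m - 1\<close> is even, alternation along the row gives equal values
    at columns 0 and \<open>m - 1\<close>, but the wrap-around edge joins them.\<close>
  have "h (m - 1) = h 0"
    using alt[of "m - 1"] assms by simp
  then show False
    using h[of "m - 1"] assms by simp
qed

lemma not_lid_coloring_four_triangle_cylinder:
  assumes "n \<ge> 2"
  shows "\<not> lid_coloring (cylinder 3 n) 4 f"
proof
  assume f: "lid_coloring (cylinder 3 n) 4 f"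
  define T where "T = f ` ({..<3} \<times> {0})"
  have lt3: "{..<3} = {0, 1, 2::nat}" by auto
  \<comment> \<open>The triangle puts the whole row into each closed neighborhood, and the boundary
    row 0 has a single vertical neighbor, so at most one color joins \<open>T\<close>.\<close>
  have S: "f ` closed_nbhd (cylinder 3 n) (i, 0) = insert (f (i, 1)) T" if "i < 3" for i
  proof -
    have "{j'. j' < n \<and> (j' = 0 + 1 \<or> 0 = j' + 1)} = {1}"
      using assms by auto
    then have N: "closed_nbhd (cylinder 3 n) (i, 0) =
        insert (i, 1) ({i, (i + 1) mod 3, (i + 2) mod 3} \<times> {0})"
      using that assms by (subst closed_nbhd_cylinder) auto
    have "i = 0 \<or> i = 1 \<or> i = 2"
      using that by auto
    then have R: "{i, (i + 1) mod 3, (i + 2) mod 3} = {..<3}"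
      unfolding lt3 by auto
    show ?thesis
      unfolding N R T_def by simp
  qed
  have e: "((i, 0), (i', 0)) \<in> parcs (cylinder 3 n)" if "i < 3" "i' < 3" "i \<noteq> i'" for i i'
  proof -
    have "i = 0 \<or> i = 1 \<or> i = 2" "i' = 0 \<or> i' = 1 \<or> i' = 2"
      using that by auto
    then show ?thesis
      using that(3) assms by (elim disjE) (simp_all add: parcs_cylinder_iff)
  qed
  have "f (i, 0) \<noteq> f (i', 0)" if "i < 3" "i' < 3" "i \<noteq> i'" for i i'
    using f e[OF that] unfolding lid_coloring_def proper_coloring_def by blast
  then have "inj_on f ({..<3} \<times> {0})"
    by (intro inj_onI) (metis SigmaE lessThan_iff singletonD)
  then have cT: "card T = 3"
    by (simp add: T_def card_image)
  have neq: "insert (f (i, 1)) T \<noteq> insert (f (i', 1)) T" if "i < 3" "i' < 3" "i \<noteq> i'" for i i'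
    unfolding S[OF that(1), symmetric] S[OF that(2), symmetric]
    using f e[OF that] closed_nbhd_cylinder_neq[OF _ assms e[OF that]]
    unfolding lid_coloring_def by blast
  have all: "insert (f (i, 1)) T = {1..4}" if "i < 3" "f (i, 1) \<notin> T" for i
  proof -
    have "insert (f (i, 1)) T \<subseteq> {1..4}"
      using lid_coloring_closed_nbhd_subset[OF pair_graph_cylinder f, of "(i, 0)"] S that assms
      by (simp add: pverts_cylinder)
    moreover have "card (insert (f (i, 1)) T) = 4"
      using cT that(2) by (simp add: T_def)
    ultimately show ?thesis
      using card_subset_eq[of "{1..4}" "insert (f (i, 1)) T"] by simp
  qed
  \<comment> \<open>Pigeonhole: three pairwise different sets would share two possible
    values.\<close>
  define X where "X i = insert (f (i, 1)) T" for i
  have "X i = T \<or> X i = {1..4}" if "i < 3" for i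
    using all[OF that] by (cases "f (i, 1) \<in> T") (auto simp: X_def insert_absorb)
  then have "X 0 = T \<or> X 0 = {1..4}" "X 1 = T \<or> X 1 = {1..4}" "X 2 = T \<or> X 2 = {1..4}"
    by simp_all
  moreover have "X 0 \<noteq> X 1" "X 0 \<noteq> X 2" "X 1 \<noteq> X 2"
    unfolding X_def by (rule neq; simp)+
  ultimately show False
    by metis
qed

section \<open>Upper bounds: periodic extension and explicit prism colorings\<close>

definition prism_nbhd_colors :: "nat \<Rightarrow> (nat \<Rightarrow> nat \<Rightarrow> nat) \<Rightarrow> nat \<Rightarrow> nat \<Rightarrow> nat set" where
  "prism_nbhd_colors m c i j =
    {c i j, c ((i + 1) mod m) j, c ((i + (m - 1)) mod m) j, c i (1 - j)}"

text \<open>Rows are folded by \<open>j mod 2\<close>, and \<open>1 - j\<close> is the opposite row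
  of the prism. All vertical neighbors of a vertex have opposite parity and so contribute one common
  color. Row conditions run only forward along the cycle because inequality is symmetric.\<close>

lemma lid_coloring_cylinder_of_prism:
  fixes c :: "nat \<Rightarrow> nat \<Rightarrow> nat"
  assumes "m \<ge> 3" and "n \<ge> 2"
    and range: "\<And>i j. i < m \<Longrightarrow> j < 2 \<Longrightarrow> c i j \<in> {1..k}"
    and proper_row: "\<And>i j. i < m \<Longrightarrow> j < 2 \<Longrightarrow> c i j \<noteq> c ((i + 1) mod m) j"
    and proper_col: "\<And>i. i < m \<Longrightarrow> c i 0 \<noteq> c i 1"
    and lid_row: "\<And>i j. i < m \<Longrightarrow> j < 2 \<Longrightarrow>
      prism_nbhd_colors m c i j \<noteq> prism_nbhd_colors m c ((i + 1) mod m) j"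
    and lid_col: "\<And>i. i < m \<Longrightarrow> prism_nbhd_colors m c i 0 \<noteq> prism_nbhd_colors m c i 1"
  shows "lid_coloring (cylinder m n) k (\<lambda>(i, j). c i (j mod 2))"
proof -
  let ?f = "\<lambda>(i, j). c i (j mod 2)"
  have parity: "(j + 1) mod 2 = 1 - j mod 2" "j mod 2 < 2" "j mod 2 = 0 \<or> j mod 2 = 1" for j :: nat
    by presburger+
  have S: "?f ` closed_nbhd (cylinder m n) (i, j) = prism_nbhd_colors m c i (j mod 2)"
    if "i < m" "j < n" for i j
  proof -
    let ?V = "{j'. j' < n \<and> (j' = j + 1 \<or> j = j' + 1)}"
    \<comment> \<open>A vertical neighbor exists even in a boundary row, so the opposite color
      really is seen.\<close>
    have "(if j = 0 then 1 else j - 1) \<in> ?V"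
      using that assms(2) by auto
    moreover have "j' mod 2 = 1 - j mod 2" if "j' \<in> ?V" for j'
      using that by auto presburger+
    ultimately have "(\<lambda>j'. c i (j' mod 2)) ` ?V = {c i (1 - j mod 2)}"
      by (auto simp: image_iff)
    moreover have "?f ` ({i} \<times> ?V) = (\<lambda>j'. c i (j' mod 2)) ` ?V"
      by auto
    ultimately show ?thesis
      unfolding closed_nbhd_cylinder[OF that] image_Un prism_nbhd_colors_def by auto
  qed
  have *: "?f u \<noteq> ?f v \<and> ?f ` closed_nbhd (cylinder m n) u \<noteq> ?f ` closed_nbhd (cylinder m n) v"
    if "(u, v) \<in> parcs (cylinder m n)" for u v
  proof -
    obtain i j i' j' where uv: "u = (i, j)" "v = (i', j')"
      by (cases u, cases v)
    then have b: "i < m" "i' < m" "j < n" "j' < n"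
      using that by (auto simp: parcs_cylinder_iff)
    have "i = i' \<and> j' mod 2 = 1 - j mod 2 \<or>
        j = j' \<and> (i' = (i + 1) mod m \<or> i = (i' + 1) mod m)"
      using that uv parity(1) by (auto simp: parcs_cylinder_iff)
    then consider "i = i'" "j' mod 2 = 1 - j mod 2" | "j = j'" "i' = (i + 1) mod m"
      | "j = j'" "i = (i' + 1) mod m"
      by blast
    then show ?thesis
    proof cases
      case 1
      then show ?thesis
        unfolding uv S[OF b(1,3)] S[OF b(2,4)]
        using parity(3)[of j] proper_col[OF b(1)] lid_col[OF b(1)] by auto
    next
      case 2
      then show ?thesis
        unfolding uv S[OF b(1,3)] S[OF b(2,4)]
        using proper_row[OF b(1) parity(2)[of j]] lid_row[OF b(1) parity(2)[of j]] by simp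
    next
      case 3
      then show ?thesis
        unfolding uv S[OF b(1,3)] S[OF b(2,4)]
        using proper_row[OF b(2) parity(2)[of j]] lid_row[OF b(2) parity(2)[of j]] by simp
    qed
  qed
  moreover have "?f ` pverts (cylinder m n) \<subseteq> {1..k}"
    using range parity(2) by (auto simp: pverts_cylinder)
  ultimately show ?thesis
    unfolding lid_coloring_def proper_coloring_def by blast
qed

text \<open>Vertices of color 1 see 2 and 3, one of them along the row and the other across; all
  other vertices see only 1 and their own color.\<close>

definition even_prism_coloring :: "nat \<Rightarrow> nat \<Rightarrow> nat" where
  "even_prism_coloring i j = (if odd (i + j) then 1 else 2 + j)"

lemma lid_coloring_even_cylinder:
  assumes "m \<ge> 3" and "n \<ge> 2" and "even m"
  shows "lid_coloring (cylinder m n) 3 (\<lambda>(i, j). even_prism_coloring i (j mod 2))"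
proof -
  let ?c = even_prism_coloring
  \<comment> \<open>Evenness of \<open>m\<close> makes the parity flip survive the
    wrap-around.\<close>
  have par: "even ((i + 1) mod m) = odd i" "even ((i + (m - 1)) mod m) = odd i" for i
    using assms by (auto simp: dvd_mod_iff)
  have S: "prism_nbhd_colors m ?c i j = (if odd (i + j) then {1, 2, 3} else {1, 2 + j})"
    if "j < 2" for i j
    using that par[of i]
    by (auto simp: prism_nbhd_colors_def even_prism_coloring_def less_2_cases_iff)
  have opp: "odd ((i + 1) mod m + j) \<longleftrightarrow> \<not> odd (i + j)" for i j
    using par(1)[of i] by (simp only: even_add) blast
  have neq: "{1, 2, 3} \<noteq> {1, 2 + j}" if "j < 2" for j :: nat
    using less_2_cases[OF that] by (elim disjE) (simp_all add: set_eq_subset)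
  show ?thesis
  proof (rule lid_coloring_cylinder_of_prism[OF assms(1,2)])
    show "?c i j \<in> {1..3}" if "j < 2" for i j
      using that by (simp add: even_prism_coloring_def)
    show "?c i j \<noteq> ?c ((i + 1) mod m) j" for i j
      unfolding even_prism_coloring_def opp by simp
    show "?c i 0 \<noteq> ?c i 1" for i
      by (simp add: even_prism_coloring_def)
    show "prism_nbhd_colors m ?c i j \<noteq> prism_nbhd_colors m ?c ((i + 1) mod m) j" if "j < 2" for i j
      unfolding S[OF that] opp using neq[OF that] by (cases "odd (i + j)") auto
    show "prism_nbhd_colors m ?c i 0 \<noteq> prism_nbhd_colors m ?c i 1" for i
      using neq[of 0] neq[of 1] by (cases "odd i") (auto simp: S)
  qed
qed

text \<open>From column 3 on this is the even pattern with colors 2 and 3 exchanged. Columns 0 to 2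
  absorb the parity defect; color 4 occurs only in row 1 of columns 0 and 2.\<close>

definition odd_prism_coloring :: "nat \<Rightarrow> nat \<Rightarrow> nat" where
  "odd_prism_coloring i j =
    (if i = 0 then (if j = 0 then 1 else 4)
     else if i = 1 then (if j = 0 then 3 else 2)
     else if i = 2 then (if j = 0 then 2 else 4)
     else if odd i then (if j = 0 then 1 else 2)
     else (if j = 0 then 3 else 1))"

lemma lid_coloring_odd_cylinder:
  assumes "m \<ge> 5" and "n \<ge> 2" and "odd m"
  shows "lid_coloring (cylinder m n) 4 (\<lambda>(i, j). odd_prism_coloring i (j mod 2))"
proof -
  let ?c = odd_prism_coloring
  have succ: "(i + 1) mod m = (if m = Suc i then 0 else i + 1)"
    and pred: "(i + (m - 1)) mod m = (if i = 0 then m - 1 else i - 1)" if "i < m" for i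
    using that by (auto simp: mod_if)
  \<comment> \<open>Column 3 and the last column border exceptional columns and need their own
    cases; from column 4 on, the others depend only on parity. The last index \<open>m - 1\<close>
    is even and at least 4.\<close>
  have cases: "i = 0 \<or> i = 1 \<or> i = 2 \<or> i = 3 \<or> 4 \<le> i \<and> odd i \<and> Suc i < m \<or>
      4 \<le> i \<and> even i \<and> m = Suc i \<or> 4 \<le> i \<and> even i \<and> Suc i < m" if "i < m" for i
    using that assms by (cases "m = Suc i") auto
  define S where "S i j =
    (if i = 0 then (if j = 0 then {1, 3, 4} else {1, 2, 4})
     else if i = 1 then (if j = 0 then {1, 2, 3} else {2, 3, 4})
     else if i = 2 then (if j = 0 then {1, 2, 3, 4} else {2, 4})
     else if i = 3 then (if j = 0 then {1, 2, 3} else {1, 2, 4})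
     else if odd i then (if j = 0 then {1, 2, 3} else {1, 2})
     else if m = Suc i then (if j = 0 then {1, 3} else {1, 2, 3, 4})
     else (if j = 0 then {1, 3} else {1, 2, 3::nat}))" for i j :: nat
  have S: "prism_nbhd_colors m ?c i j = S i j" if "i < m" "j < 2" for i j
  proof -
    show ?thesis
      unfolding prism_nbhd_colors_def succ[OF that(1)] pred[OF that(1)]
      using cases[OF that(1)] that assms
      by (elim disjE conjE; cases "j = 0") (auto simp: S_def odd_prism_coloring_def)
  qed
  show ?thesis
  proof (rule lid_coloring_cylinder_of_prism)
    fix i j :: nat assume ij: "i < m" "j < 2"
    have "?c i j \<noteq> ?c ((i + 1) mod m) j \<and> S i j \<noteq> S ((i + 1) mod m) j"
      unfolding succ[OF ij(1)]
      using cases[OF ij(1)] ij assms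
      by (elim disjE conjE; cases "j = 0") (simp_all add: S_def odd_prism_coloring_def set_eq_subset)
    then show "?c i j \<noteq> ?c ((i + 1) mod m) j"
      "prism_nbhd_colors m ?c i j \<noteq> prism_nbhd_colors m ?c ((i + 1) mod m) j"
      using ij by (auto simp: S)
  next
    fix i assume i: "i < m"
    have "S i 0 \<noteq> S i 1"
      using cases[OF i] by (elim disjE conjE) (simp_all add: S_def set_eq_subset)
    then show "prism_nbhd_colors m ?c i 0 \<noteq> prism_nbhd_colors m ?c i 1"
      using i by (simp add: S)
  qed (use assms in \<open>auto simp: odd_prism_coloring_def\<close>)
qed

text \<open>The rows use 1, 2, 4 and 2, 3, 5. A vertex sees its own row and the color opposite.
  Sharing only color 2, exactly one vertex per row gains nothing, while the other two gain different
  colors.\<close>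

definition triangle_prism_coloring :: "nat \<Rightarrow> nat \<Rightarrow> nat" where
  "triangle_prism_coloring i j =
    (if i = 0 then (if j = 0 then 1 else 2)
     else if i = 1 then (if j = 0 then 2 else 3)
     else (if j = 0 then 4 else 5))"

lemma lid_coloring_triangle_cylinder:
  assumes "n \<ge> 2"
  shows "lid_coloring (cylinder 3 n) 5 (\<lambda>(i, j). triangle_prism_coloring i (j mod 2))"
proof (rule lid_coloring_cylinder_of_prism)
  let ?c = triangle_prism_coloring
  have lt3: "i = 0 \<or> i = 1 \<or> i = 2" if "i < 3" for i :: nat
    using that by auto
  show "?c i j \<in> {1..5}" for i j
    by (simp add: triangle_prism_coloring_def)
  show "?c i 0 \<noteq> ?c i 1" for i
    by (simp add: triangle_prism_coloring_def)
  show "?c i j \<noteq> ?c ((i + 1) mod 3) j" if "i < 3" "j < 2" for i j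
    using lt3[OF that(1)] by (auto simp: triangle_prism_coloring_def)
  show "prism_nbhd_colors 3 ?c i j \<noteq> prism_nbhd_colors 3 ?c ((i + 1) mod 3) j"
    if "i < 3" "j < 2" for i j
    using lt3[OF that(1)] that(2)
    by (elim disjE; cases "j = 0")
      (simp_all add: prism_nbhd_colors_def triangle_prism_coloring_def set_eq_subset)
  show "prism_nbhd_colors 3 ?c i 0 \<noteq> prism_nbhd_colors 3 ?c i 1" if "i < 3" for i
    using lt3[OF that(1)]
    by (elim disjE)
      (simp_all add: prism_nbhd_colors_def triangle_prism_coloring_def set_eq_subset)
qed (use assms in simp_all)

theorem theorem5:
  fixes m n :: nat
  assumes "m \<ge> 3" and "n \<ge> 2"
  shows "lid_chromatic_number (cartesian_product (cycle_graph m) (path_graph n)) =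
    (if m = 3 then 5 else if odd m then 4 else 3)"
proof -
  have e: "((0, 0), (0, 1)) \<in> parcs (cylinder m n)"
    using assms by (simp add: parcs_cylinder_iff)
  have two: "\<not> lid_coloring (cylinder m n) 2 f" for f
    by (rule not_lid_coloring_two[OF pair_graph_cylinder e closed_nbhd_cylinder_neq])
      (use assms e in auto)
  \<comment> \<open>Singling out 4 leaves \<open>m = 3\<close> or \<open>m \<ge> 5\<close>. Each
    case then pairs a coloring with the exclusion of one color fewer: 4, 3 and 2
    respectively.\<close>
  consider "m = 3" | "m \<ge> 5" "odd m" | "even m"
    using assms(1) by (cases "m = 4") force+
  then have "lid_chromatic_number (cylinder m n) =
    (if m = 3 then 5 else if odd m then 4 else 3)"
  proof cases
    case 1
    then show ?thesis
      using lid_chromatic_number_eqI[of "cylinder m n" 4] lid_coloring_triangle_cylinder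
        not_lid_coloring_four_triangle_cylinder assms(2) by auto
  next
    case 2
    then show ?thesis
      using lid_chromatic_number_eqI[of "cylinder m n" 3] lid_coloring_odd_cylinder
        not_lid_coloring_three_odd_cylinder assms by auto
  next
    case 3
    then show ?thesis
      using lid_chromatic_number_eqI[of "cylinder m n" 2] lid_coloring_even_cylinder
        two assms by auto
  qed
  then show ?thesis
    by (simp add: cylinder_def)
qed

end
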